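(* Let $\{A_{\mathbf n}=[a_{\mathbf i\mathbf j}^{(\mathbf n)}]_{\mathbf i,\mathbf j=\mathbf 1}^{\mathbf n}\}_n$ be a $d$-level $(r,s)$-block GLT sequence with symbol $\kappa$. Fix a choice of $\tilde r$ of the $r$ row indices and $\tilde s$ of the $s$ column indices, and let $\tilde a_{\mathbf i\mathbf j}^{(\mathbf n)}$ be the $\tilde r\times\tilde s$ submatrix of the $r\times s$ block $a_{\mathbf i\mathbf j}^{(\mathbf n)}$ corresponding to the chosen rows and columns (the same choice for all $\mathbf i,\mathbf j,\mathbf n$). Then $\{\tilde A_{\mathbf n}=[\tilde a_{\mathbf i\mathbf j}^{(\mathbf n)}]_{\mathbf i,\mathbf j=\mathbf 1}^{\mathbf n}\}_n$ is a $d$-level $(\tilde r,\tilde s)$-block GLT sequence whose symbol $\tilde\kappa$ is the corresponding $\tilde r\times\tilde s$ submatrix of $\kappa$.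
   Context: Conventions. A $d$-index is a vector in $\mathbb Z^d$. For $\mathbf n\in\mathbb N^d$ ($\mathbb N=\{1,2,\dots\}$) put $N(\mathbf n)=\prod_{i=1}^d n_i$; $\mathbf n\to\infty$ means $\min_i n_i\to\infty$. Operations and inequalities between $d$-indices are componentwise, $\mathbf 1=(1,\dots,1)$, and $\mathbf i=\mathbf 1,\dots,\mathbf n$ means that $\mathbf i$ ranges over $\{\mathbf i\in\mathbb Z^d:\mathbf 1\le\mathbf i\le\mathbf n\}$ in lexicographic order. A $d$-level $(r,s)$-block matrix with level orders $\mathbf n$ is a matrix $X=[x_{\mathbf i\mathbf j}]_{\mathbf i,\mathbf j=\mathbf 1}^{\mathbf n}$ of size $N(\mathbf n)r\times N(\mathbf n)s$ whose entries $x_{\mathbf i\mathbf j}$ are $r\times s$ complex blocks. A $d$-level $(r,s)$-block matrix-sequence is a sequence $\{A_{\mathbf n}\}_n$ where $n$ varies in an infinite subset of $\mathbb N$, $\mathbf n=\mathbf n(n)\in\mathbb N^d$ satisfies $\mathbf n\to\infty$ as $n\to\infty$, and $A_{\mathbf n}$ is an $N(\mathbf n)r\times N(\mathbf n)s$ matrix (regarded as a $d$-level $(r,s)$-block matrix); "$s$-block" means "$(s,s)$-block". Matrix-valued functions are measurable, continuous a.e., convergent in measure, etc. if their components are (Lebesgue measure); $I_s$ is the $s\times s$ identity. Toeplitz and sampling matrices. For $f:[-\pi,\pi]^d\to\mathbb C^{r\times s}$ in $L^1$, with Fourier coefficients $f_{\mathbf k}=(2\pi)^{-d}\int_{[-\pi,\pi]^d}f(\boldsymbol\theta)e^{-\mathrm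 i\mathbf k\cdot\boldsymbol\theta}d\boldsymbol\theta$, let $T_{\mathbf n}(f)=[f_{\mathbf i-\mathbf j}]_{\mathbf i,\mathbf j=\mathbf 1}^{\mathbf n}$. For $a:[0,1]^d\to\mathbb C^{r\times s}$ let $D_{\mathbf n}(a)$ be the block diagonal matrix $\mathrm{diag}_{\mathbf i=\mathbf 1,\dots,\mathbf n}\,a(\mathbf i/\mathbf n)$. A.c.s. If $A_n$ and $B_{n,m}$ are $d_n\times e_n$ matrices, $\{B_{n,m}\}_n\xrightarrow{\rm a.c.s.}\{A_n\}_n$ (as $m\to\infty$) means: for every $m$ there is $n_m$ such that for $n\ge n_m$, $A_n=B_{n,m}+R_{n,m}+N_{n,m}$ with $\mathrm{rank}(R_{n,m})\le c(m)\min(d_n,e_n)$ and $\|N_{n,m}\|\le\omega(m)$ (spectral norm), where $n_m,c(m),\omega(m)$ depend only on $m$ and $c(m),\omega(m)\to0$ as $m\to\infty$. Square GLT sequences. For a $d$-level $s$-block matrix-sequence $\{A_{\mathbf n}\}_n$ and a measurable $\kappa:[0,1]^d\times[-\pi,\pi]^d\to\mathbb C^{s\times s}$, one writes $\{A_{\mathbf n}\}_n\sim_{\rm GLT}\kappa$ ("$\{A_{\mathbf n}\}_n$ is a $d$-level $s$-block GLT sequence with symbol $\kappa$") if (this characterization is equivalent to the original definition) for every $m$ there are finitely many functions $a_{i,m}\in C^\infty([0,1]^d)$ (complex-valued) and trigonometric monomials $f_{i,m}\in\{e^{\mathrm i\mathbf j\cdot\boldsymbol\theta}E_{\alpha\beta}^{(s)}:\mathbf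 j\in\mathbb Z^d,1\le\alpha,\beta\le s\}$, $i=1,\dots,N_m$, where $E^{(s)}_{\alpha\beta}$ is the $s\times s$ matrix with $1$ in position $(\alpha,\beta)$ and $0$ elsewhere, such that $\sum_{i=1}^{N_m}a_{i,m}(\mathbf x)f_{i,m}(\boldsymbol\theta)\to\kappa(\mathbf x,\boldsymbol\theta)$ a.e. as $m\to\infty$ and $\{\sum_{i=1}^{N_m}D_{\mathbf n}(a_{i,m}I_s)T_{\mathbf n}(f_{i,m})\}_n\xrightarrow{\rm a.c.s.}\{A_{\mathbf n}\}_n$. Extension operator. For $t\ge\max(r,s)$ and $x\in\mathbb C^{r\times s}$, $E_{r,s}^t(x)=\begin{bmatrix}x&O\\O&O\end{bmatrix}\in\mathbb C^{t\times t}$; for a $d$-level $(r,s)$-block matrix $X=[x_{\mathbf i\mathbf j}]$, $E_{r,s}^t(X)=[E_{r,s}^t(x_{\mathbf i\mathbf j})]_{\mathbf i,\mathbf j=\mathbf 1}^{\mathbf n}$ (a $d$-level $t$-block matrix). Rectangular GLT sequences. For a $d$-level $(r,s)$-block matrix-sequence $\{A_{\mathbf n}\}_n$ and a measurable $\kappa:[0,1]^d\times[-\pi,\pi]^d\to\mathbb C^{r\times s}$, one writes $\{A_{\mathbf n}\}_n\sim_{\rm GLT}\kappa$ ("$\{A_{\mathbf n}\}_n$ is a $d$-level $(r,s)$-block GLT sequence with symbol $\kappa$") if $\{E_{r,s}^t(A_{\mathbf n})\}_n\sim_{\rm GLT}E_{r,s}^t(\kappa)$ in the square sense for all $t\ge\max(r,s)$;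 equivalently, for some $t\ge\max(r,s)$. For $r=s$ this agrees with the square notion. *)

theory Defs
  imports
    "HOL-Analysis.Analysis"
    "HOL-Library.Fun_Lexorder"
    "Jordan_Normal_Form.DL_Rank"
    "Jordan_Normal_Form.DL_Submatrix"
begin

text \<open>
  The number \<open>d\<close> of levels is the cardinality of the linearly ordered finite type \<open>'d\<close>.
  Points of \<open>[0,1]^d\<close> and \<open>[-pi,pi]^d\<close> live in \<open>real ^ 'd\<close>; a \<open>d\<close>-index is a function on \<open>'d\<close>,
  with values in \<open>nat\<close> for level orders and positions (counted from 1) and in \<open>int\<close> for
  Fourier frequencies. Matrices, and indices inside a block, are counted from 0.
\<close>

no_notation vec_nth (infixl \<open>$\<close> 90)
notation vec_nth (infixl \<open>$h\<close> 90)

type_synonym 'd point = "(real, 'd) Finite_Cartesian_Product.vec"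

subsection \<open>Multi-indices and block matrices\<close>

definition level_size :: "('d::finite \<Rightarrow> nat) \<Rightarrow> nat" where
  "level_size n = (\<Prod>l\<in>UNIV. n l)"

definition indices :: "('d \<Rightarrow> nat) \<Rightarrow> ('d \<Rightarrow> nat) set" where
  "indices n = {i. \<forall>l. 1 \<le> i l \<and> i l \<le> n l}"

text \<open>\<open>less_fun\<close> is the lexicographic order on functions.\<close>

definition lex_pos :: "('d::linorder \<Rightarrow> nat) \<Rightarrow> ('d \<Rightarrow> nat) \<Rightarrow> nat" where
  "lex_pos n i = card {j \<in> indices n. less_fun j i}"

definition lex_nth :: "('d::linorder \<Rightarrow> nat) \<Rightarrow> nat \<Rightarrow> ('d \<Rightarrow> nat)" where
  "lex_nth n = the_inv_into (indices n) (lex_pos n)"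

definition of_blocks ::
  "('d::{finite,linorder} \<Rightarrow> nat) \<Rightarrow> nat \<Rightarrow> nat \<Rightarrow>
    (('d \<Rightarrow> nat) \<Rightarrow> ('d \<Rightarrow> nat) \<Rightarrow> complex mat) \<Rightarrow> complex mat" where
  "of_blocks n r s x = Matrix.mat (level_size n * r) (level_size n * s)
     (\<lambda>(p, q). x (lex_nth n (p div r)) (lex_nth n (q div s)) $$ (p mod r, q mod s))"

definition block ::
  "('d::linorder \<Rightarrow> nat) \<Rightarrow> nat \<Rightarrow> nat \<Rightarrow> complex mat \<Rightarrow>
    ('d \<Rightarrow> nat) \<Rightarrow> ('d \<Rightarrow> nat) \<Rightarrow> complex mat" where
  "block n r s X i j =
     Matrix.mat r s (\<lambda>(\<alpha>, \<beta>). X $$ (lex_pos n i * r + \<alpha>, lex_pos n j * s + \<beta>))"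

text \<open>The index set \<open>K\<close> is the infinite set of naturals in which the sequence parameter varies;
  \<open>\<nu> n\<close> is the vector of level orders of the \<open>n\<close>-th matrix.\<close>

definition block_matrix_seq ::
  "nat set \<Rightarrow> (nat \<Rightarrow> 'd::finite \<Rightarrow> nat) \<Rightarrow> nat \<Rightarrow> nat \<Rightarrow> (nat \<Rightarrow> complex mat) \<Rightarrow> bool" where
  "block_matrix_seq K \<nu> r s A \<longleftrightarrow>
     infinite K \<and>
     (\<forall>n\<in>K. \<forall>l. 1 \<le> \<nu> n l) \<and>
     filterlim (\<lambda>n. Min (range (\<nu> n))) at_top (inf sequentially (principal K)) \<and>
     (\<forall>n\<in>K. A n \<in> carrier_mat (level_size (\<nu> n) * r) (level_size (\<nu> n) * s))"

subsection \<open>Toeplitz and sampling matrices\<close>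

abbreviation unit_cube :: "'d::finite point set" where
  "unit_cube \<equiv> {x. \<forall>l. x $h l \<in> {0..1}}"

abbreviation freq_cube :: "'d::finite point set" where
  "freq_cube \<equiv> {\<theta>. \<forall>l. \<theta> $h l \<in> {-pi..pi}}"

definition dot :: "('d::finite \<Rightarrow> int) \<Rightarrow> 'd point \<Rightarrow> real" where
  "dot k \<theta> = (\<Sum>l\<in>UNIV. of_int (k l) * \<theta> $h l)"

definition fourier_coeff ::
  "nat \<Rightarrow> nat \<Rightarrow> ('d::finite point \<Rightarrow> complex mat) \<Rightarrow> ('d \<Rightarrow> int) \<Rightarrow> complex mat" where
  "fourier_coeff r s f k = Matrix.mat r s (\<lambda>(\<alpha>, \<beta>).
     (LINT \<theta>|lebesgue_on freq_cube. f \<theta> $$ (\<alpha>, \<beta>) * exp (- (\<i> * of_real (dot k \<theta>))))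
       / of_real ((2 * pi) ^ CARD('d)))"

definition toeplitz ::
  "('d::{finite,linorder} \<Rightarrow> nat) \<Rightarrow> nat \<Rightarrow> nat \<Rightarrow> ('d point \<Rightarrow> complex mat) \<Rightarrow> complex mat" where
  "toeplitz n r s f =
     of_blocks n r s (\<lambda>i j. fourier_coeff r s f (\<lambda>l. int (i l) - int (j l)))"

definition sampling ::
  "('d::{finite,linorder} \<Rightarrow> nat) \<Rightarrow> nat \<Rightarrow> nat \<Rightarrow> ('d point \<Rightarrow> complex mat) \<Rightarrow> complex mat" where
  "sampling n r s a =
     of_blocks n r s (\<lambda>i j. if i = j then a (\<chi> l. real (i l) / real (n l)) else 0\<^sub>m r s)"

subsection \<open>Approximating classes of sequences\<close>

definition eucl_norm :: "complex Matrix.vec \<Rightarrow> real" where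
  "eucl_norm v = L2_set (\<lambda>i. cmod (v $ i)) {..<dim_vec v}"

text \<open>Taking the supremum over the closed unit ball keeps the index set nonempty even for matrices
  without columns.\<close>

definition spectral_norm :: "complex mat \<Rightarrow> real" where
  "spectral_norm X =
     (SUP v \<in> {v \<in> carrier_vec (dim_col X). eucl_norm v \<le> 1}. eucl_norm (X *\<^sub>v v))"

definition mat_rank :: "complex mat \<Rightarrow> nat" where
  "mat_rank X = vec_space.rank (dim_row X) X"

definition acs ::
  "nat set \<Rightarrow> (nat \<Rightarrow> nat) \<Rightarrow> (nat \<Rightarrow> nat) \<Rightarrow>
    (nat \<Rightarrow> nat \<Rightarrow> complex mat) \<Rightarrow> (nat \<Rightarrow> complex mat) \<Rightarrow> bool" where
  "acs K d e B A \<longleftrightarrow>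
     (\<forall>n\<in>K. A n \<in> carrier_mat (d n) (e n) \<and> (\<forall>m. B n m \<in> carrier_mat (d n) (e n))) \<and>
     (\<exists>(n0 :: nat \<Rightarrow> nat) (c :: nat \<Rightarrow> real) (\<omega> :: nat \<Rightarrow> real).
        c \<longlonglongrightarrow> 0 \<and> \<omega> \<longlonglongrightarrow> 0 \<and>
        (\<forall>m. \<forall>n\<in>K. n0 m \<le> n \<longrightarrow>
          (\<exists>R N. R \<in> carrier_mat (d n) (e n) \<and> N \<in> carrier_mat (d n) (e n) \<and>
             A n = B n m + R + N \<and>
             real (mat_rank R) \<le> c m * real (min (d n) (e n)) \<and>
             spectral_norm N \<le> \<omega> m)))"

subsection \<open>Square GLT sequences\<close>

primrec times_cont_differentiable_on ::
  "nat \<Rightarrow> 'a::real_normed_vector set \<Rightarrow> ('a \<Rightarrow> 'b::real_normed_vector) \<Rightarrow> bool" where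
  "times_cont_differentiable_on 0 S f \<longleftrightarrow> continuous_on S f"
| "times_cont_differentiable_on (Suc k) S f \<longleftrightarrow>
     (\<forall>x\<in>S. f differentiable (at x)) \<and>
     (\<forall>v. times_cont_differentiable_on k S (\<lambda>x. frechet_derivative f (at x) v))"

text \<open>\<open>C\<^sup>\<infinity>\<close> on the closed cube means: restriction of a \<open>C\<^sup>\<infinity>\<close> function on the whole space.\<close>

definition smooth_on_cube :: "('d::finite point \<Rightarrow> complex) \<Rightarrow> bool" where
  "smooth_on_cube a \<longleftrightarrow>
     (\<exists>g. (\<forall>k. times_cont_differentiable_on k UNIV g) \<and> (\<forall>x\<in>unit_cube. a x = g x))"

definition unit_matrix :: "nat \<Rightarrow> nat \<Rightarrow> nat \<Rightarrow> complex mat" where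
  "unit_matrix s \<alpha> \<beta> = Matrix.mat s s (\<lambda>(p, q). if p = \<alpha> \<and> q = \<beta> then 1 else 0)"

definition trig_monomials :: "nat \<Rightarrow> ('d::finite point \<Rightarrow> complex mat) set" where
  "trig_monomials s =
     {\<lambda>\<theta>. exp (\<i> * of_real (dot k \<theta>)) \<cdot>\<^sub>m unit_matrix s \<alpha> \<beta> | k \<alpha> \<beta>. \<alpha> < s \<and> \<beta> < s}"

text \<open>The type of complex matrices of all sizes has no zero, so finite sums of \<open>k \<times> l\<close> matrices are
  taken entrywise.\<close>

definition mat_sum :: "nat \<Rightarrow> nat \<Rightarrow> ('i \<Rightarrow> complex mat) \<Rightarrow> 'i set \<Rightarrow> complex mat" where
  "mat_sum k l X S = Matrix.mat k l (\<lambda>(p, q). \<Sum>i\<in>S. X i $$ (p, q))"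

text \<open>A symbol is only relevant on \<open>unit_cube \<times> freq_cube\<close>; values elsewhere are arbitrary.\<close>

definition measurable_symbol ::
  "nat \<Rightarrow> nat \<Rightarrow> ('d::finite point \<times> 'd point \<Rightarrow> complex mat) \<Rightarrow> bool" where
  "measurable_symbol r s \<kappa> \<longleftrightarrow>
     (\<forall>z \<in> unit_cube \<times> freq_cube. \<kappa> z \<in> carrier_mat r s) \<and>
     (\<forall>\<alpha><r. \<forall>\<beta><s.
        (\<lambda>z. \<kappa> z $$ (\<alpha>, \<beta>)) \<in> borel_measurable (lebesgue_on (unit_cube \<times> freq_cube)))"

definition square_glt ::
  "nat set \<Rightarrow> (nat \<Rightarrow> 'd::{finite,linorder} \<Rightarrow> nat) \<Rightarrow> nat \<Rightarrow> (nat \<Rightarrow> complex mat) \<Rightarrow>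
    ('d point \<times> 'd point \<Rightarrow> complex mat) \<Rightarrow> bool" where
  "square_glt K \<nu> s A \<kappa> \<longleftrightarrow>
     block_matrix_seq K \<nu> s s A \<and>
     measurable_symbol s s \<kappa> \<and>
     (\<exists>(M :: nat \<Rightarrow> nat) (a :: nat \<Rightarrow> nat \<Rightarrow> 'd point \<Rightarrow> complex)
        (f :: nat \<Rightarrow> nat \<Rightarrow> 'd point \<Rightarrow> complex mat).
        (\<forall>m. \<forall>i<M m. smooth_on_cube (a m i) \<and> f m i \<in> trig_monomials s) \<and>
        (AE z in lebesgue_on (unit_cube \<times> freq_cube).
           \<forall>\<alpha><s. \<forall>\<beta><s.
             (\<lambda>m. mat_sum s s (\<lambda>i. a m i (fst z) \<cdot>\<^sub>m f m i (snd z)) {..<M m} $$ (\<alpha>, \<beta>))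
               \<longlonglongrightarrow> \<kappa> z $$ (\<alpha>, \<beta>)) \<and>
        acs K (\<lambda>n. level_size (\<nu> n) * s) (\<lambda>n. level_size (\<nu> n) * s)
          (\<lambda>n m. mat_sum (level_size (\<nu> n) * s) (level_size (\<nu> n) * s)
             (\<lambda>i. sampling (\<nu> n) s s (\<lambda>x. a m i x \<cdot>\<^sub>m 1\<^sub>m s) * toeplitz (\<nu> n) s s (f m i))
             {..<M m})
          A)"

subsection \<open>Rectangular GLT sequences\<close>

definition extend :: "nat \<Rightarrow> nat \<Rightarrow> nat \<Rightarrow> complex mat \<Rightarrow> complex mat" where
  "extend r s t x =
     four_block_mat x (0\<^sub>m r (t - s)) (0\<^sub>m (t - r) s) (0\<^sub>m (t - r) (t - s))"

definition extend_blocks ::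
  "('d::{finite,linorder} \<Rightarrow> nat) \<Rightarrow> nat \<Rightarrow> nat \<Rightarrow> nat \<Rightarrow> complex mat \<Rightarrow> complex mat" where
  "extend_blocks n r s t X = of_blocks n t t (\<lambda>i j. extend r s t (block n r s X i j))"

definition glt ::
  "nat set \<Rightarrow> (nat \<Rightarrow> 'd::{finite,linorder} \<Rightarrow> nat) \<Rightarrow> nat \<Rightarrow> nat \<Rightarrow> (nat \<Rightarrow> complex mat) \<Rightarrow>
    ('d point \<times> 'd point \<Rightarrow> complex mat) \<Rightarrow> bool" where
  "glt K \<nu> r s A \<kappa> \<longleftrightarrow>
     block_matrix_seq K \<nu> r s A \<and>
     measurable_symbol r s \<kappa> \<and>
     (\<forall>t \<ge> max r s.
        square_glt K \<nu> t (\<lambda>n. extend_blocks (\<nu> n) r s t (A n)) (\<lambda>z. extend r s t (\<kappa> z)))"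

end

theory Submission
  imports Defs
begin

text \<open>
  Deleting rows and columns of the blocks, followed by zero padding, is the map \<open>X \<mapsto> L X R\<close> for
  partial permutation matrices \<open>L\<close> and \<open>R\<close> that are block diagonal with a constant block. Such a map
  increases neither rank nor spectral norm, hence preserves a.c.s. convergence; and, commuting with
  the scalar sampling matrices, it sends each term \<open>D\<^sub>n(a I) T\<^sub>n(f)\<close> to the term for the
  coefficient-wise compressed \<open>f\<close>, which is again a trigonometric monomial or zero.
\<close>

section \<open>Rank\<close>

text \<open>The notion \<open>glt\<close> asks for every padding size
  \<open>t \<ge> max r' s'\<close>, but the single instance \<open>T = max r s\<close> of the
  hypothesis already yields all of them. The two sizes are unrelated: \<open>t\<close> may lie below
  \<open>T\<close>, when many rows and columns are dropped, or above it. The selection therefore has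
  to change the block size, so the old and the new sequence consist of matrices of different orders;
  since rank in \<open>acs\<close> is measured relative to the order, the rank constants get
  rescaled by \<open>T / t\<close>. Working with injections on positions instead of products L X R
  turns deletion and padding into one entry formula and reduces the block structure to
  \<open>div\<close> and \<open>mod\<close>. The degenerate size \<open>t = 0\<close> does occur,
  namely for \<open>r' = s' = 0\<close>, and needs care because \<open>trig_monomials 0\<close> is
  empty.\<close>

lemma (in vec_space) rank_mult_le:
  assumes C: "C \<in> carrier_mat n k" and D: "D \<in> carrier_mat k nc"
  shows "rank (C * D) \<le> k"
proof -
  have CD: "C * D \<in> carrier_mat n nc" using C D by simp
  have cC: "set (cols C) \<subseteq> carrier_vec n" using C cols_dim by blast
  have sub: "set (cols (C * D)) \<subseteq> span (set (cols C))"
  proof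
    fix v assume "v \<in> set (cols (C * D))"
    then obtain j where j: "j < nc" "v = col (C * D) j"
      using CD by (metis carrier_matD(2) cols_length cols_nth in_set_conv_nth)
    have "v = C *\<^sub>v col D j" using j col_mult2[OF C D] by simp
    also have "\<dots> = lincomb_list (\<lambda>i. col D j $ i) (cols C)"
    proof -
      have "mat_of_cols n (cols C) = C" using C mat_of_cols_cols[of C] by auto
      moreover have "Matrix.vec (length (cols C)) (\<lambda>i. col D j $ i) = col D j" using C D by auto
      ultimately show ?thesis
        using lincomb_list_as_mat_mult[of "cols C" "\<lambda>i. col D j $ i"] cC
        by (auto simp: subset_iff)
    qed
    also have "\<dots> \<in> span_list (cols C)" by (auto simp: span_list_def)
    finally show "v \<in> span (set (cols C))" using span_list_as_span[OF cC] by simp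
  qed
  have s1: "subspace class_ring (span (set (cols C))) V" using span_is_subspace[OF cC] .
  have s2: "subspace class_ring (span (set (cols (C * D)))) V"
    by (rule span_is_subspace) (use CD cols_dim in blast)
  have "span (set (cols (C * D))) \<subseteq> span (set (cols C))"
    using sub by (simp add: cC span_is_submodule span_is_subset)
  from vectorspace.subspace_dim[OF subspace_is_vs[OF s1] nested_subspaces[OF s1 s2 this]]
  have "rank (C * D) \<le> rank C" unfolding rank_def
    using fin_dim_span_cols[OF C] fin_dim_span_cols[OF CD] by auto
  then show ?thesis using rank_le_nc[OF C] by simp
qed

text \<open>Together with \<open>rank_mult_le\<close> this identifies the rank as the least inner
  dimension of a factorization. In that form a rank bound survives any operation that acts on the
  rows of the left factor and on the columns of the right one.\<close>

lemma (in vec_space) rank_factorization: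
  assumes X: "X \<in> carrier_mat n nc"
  obtains C D where "C \<in> carrier_mat n (rank X)" "D \<in> carrier_mat (rank X) nc" "X = C * D"
proof -
  have cX: "set (cols X) \<subseteq> carrier_vec n" using X cols_dim by blast
  \<comment> \<open>\<open>U\<close> becomes a basis of the column space: a column outside its span
    could be adjoined, against maximality.\<close>
  obtain U where U: "maximal U (\<lambda>T. T \<subseteq> set (cols X) \<and> lin_indpt T)" and fU: "finite U"
    using maximal_exists_superset[of "set (cols X)" "\<lambda>T. T \<subseteq> set (cols X) \<and> lin_indpt T" "{}"]
    by (metis (no_types, lifting) List.finite_set empty_subsetI fin_dim finite_basis_exists
        subset_li_is_li vec_vs vectorspace.basis_def)
  have sub: "U \<subseteq> set (cols X)" and li: "lin_indpt U" using U unfolding maximal_def by auto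
  have cU: "U \<subseteq> carrier_vec n" using sub cX by blast
  have rk: "rank X = card U" by (rule rank_card_indpt[OF X U])
  have in_span: "v \<in> span U" if v: "v \<in> set (cols X)" for v
  proof (rule ccontr)
    assume nv: "v \<notin> span U"
    have "v \<notin> U" using nv cU span_mem by auto
    moreover have "lin_indpt (U \<union> {v})"
      using lin_dep_iff_in_span[OF cU li _ \<open>v \<notin> U\<close>] nv v cX by auto
    ultimately show False using U v unfolding maximal_def by blast
  qed
  obtain us where us: "set us = U" "distinct us" using fU finite_distinct_list by blast
  have len: "length us = rank X" using us rk distinct_card by metis
  define C where "C = mat_of_cols n us"
  have C: "C \<in> carrier_mat n (rank X)" unfolding C_def using len by auto
  have colsC: "cols C = us" unfolding C_def by (rule cols_mat_of_cols) (use us cU in auto)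
  have "\<exists>a. v = lincomb a U" if "v \<in> set (cols X)" for v
    using in_span[OF that] finite_span[OF fU cU] by auto
  then obtain a where a: "\<And>v. v \<in> set (cols X) \<Longrightarrow> v = lincomb (a v) U" by metis
  \<comment> \<open>Column \<open>j\<close> of \<open>D\<close> holds the coordinates of column
    \<open>j\<close> of \<open>X\<close> in the basis \<open>U\<close>, listed without repetition as
    the columns of \<open>C\<close>.\<close>
  define D where "D = Matrix.mat (rank X) nc (\<lambda>(i, j). a (col X j) (col C i))"
  have D: "D \<in> carrier_mat (rank X) nc" unfolding D_def by simp
  have "X = C * D"
  proof (rule mat_col_eqI)
    fix j assume "j < dim_col (C * D)"
    then have j: "j < nc" using D by simp
    have "col X j \<in> set (cols X)" using j X by (metis carrier_matD(2) cols_length cols_nth nth_mem)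
    then have "col X j = lincomb (a (col X j)) (set (cols C))" using a colsC us by simp
    also have "\<dots> = C *\<^sub>v (Matrix.vec (rank X) (\<lambda>i. a (col X j) (col C i)))"
      by (rule mat_mult_eq_lincomb[symmetric, OF C]) (simp add: colsC us)
    also have "Matrix.vec (rank X) (\<lambda>i. a (col X j) (col C i)) = col D j"
      unfolding D_def using j by auto
    finally show "col X j = col (C * D) j" using col_mult2[OF C D j] by simp
  qed (use X C D in auto)
  with C D show thesis by (rule that)
qed

section \<open>Selecting rows and columns\<close>

text \<open>\<open>P\<close> and \<open>Q\<close> are the target positions that get filled, and
  \<open>\<phi>\<close>, \<open>\<psi>\<close> lead from target to source. This is L X R where L has
  its ones at \<open>(p, \<phi> p)\<close> and R at \<open>(\<psi> q, q)\<close>, for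
  \<open>p\<close> in \<open>P\<close> and \<open>q\<close> in \<open>Q\<close>.\<close>

definition select ::
  "nat \<Rightarrow> nat \<Rightarrow> nat set \<Rightarrow> nat set \<Rightarrow> (nat \<Rightarrow> nat) \<Rightarrow> (nat \<Rightarrow> nat) \<Rightarrow> complex mat \<Rightarrow> complex mat"
  where "select d e P Q \<phi> \<psi> X =
    Matrix.mat d e (\<lambda>(p, q). if p \<in> P \<and> q \<in> Q then X $$ (\<phi> p, \<psi> q) else 0)"

lemma select_carrier [simp]: "select d e P Q \<phi> \<psi> X \<in> carrier_mat d e"
  by (simp add: select_def)

lemma select_index:
  "p < d \<Longrightarrow> q < e \<Longrightarrow>
    select d e P Q \<phi> \<psi> X $$ (p, q) = (if p \<in> P \<and> q \<in> Q then X $$ (\<phi> p, \<psi> q) else 0)"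
  by (simp add: select_def)

lemma select_add:
  assumes "X \<in> carrier_mat d' e'" "Y \<in> carrier_mat d' e'"
    and "\<phi> ` P \<subseteq> {..<d'}" "\<psi> ` Q \<subseteq> {..<e'}"
  shows "select d e P Q \<phi> \<psi> (X + Y) = select d e P Q \<phi> \<psi> X + select d e P Q \<phi> \<psi> Y"
  using assms by (intro eq_matI) (auto simp: select_def image_subset_iff)

lemma mat_sum_cong:
  assumes "\<And>i. i \<in> S \<Longrightarrow> X i = Y i"
  shows "mat_sum k l X S = mat_sum k l Y S"
  using assms by (intro eq_matI) (auto simp: mat_sum_def)

lemma select_mat_sum:
  assumes "\<phi> ` P \<subseteq> {..<d'}" "\<psi> ` Q \<subseteq> {..<e'}"
  shows "select d e P Q \<phi> \<psi> (mat_sum d' e' X S) = mat_sum d e (\<lambda>i. select d e P Q \<phi> \<psi> (X i)) S"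
  using assms by (intro eq_matI) (auto simp: select_def mat_sum_def image_subset_iff)

text \<open>Selecting rows of \<open>C\<close> and columns of \<open>D\<close> in a rank
  factorization \<open>X = C * D\<close> factors the selected matrix through the same inner
  dimension.\<close>

lemma mat_rank_select_le:
  assumes X: "X \<in> carrier_mat d' e'" and \<phi>: "\<phi> ` P \<subseteq> {..<d'}" and \<psi>: "\<psi> ` Q \<subseteq> {..<e'}"
  shows "mat_rank (select d e P Q \<phi> \<psi> X) \<le> mat_rank X"
proof -
  define k where "k = mat_rank X"
  have k: "k = vec_space.rank d' X" using X by (simp add: k_def mat_rank_def)
  obtain C D where C: "C \<in> carrier_mat d' k" and D: "D \<in> carrier_mat k e'" and CD: "X = C * D"
    using vec_space.rank_factorization[OF X] k by metis
  define C' where "C' = Matrix.mat d k (\<lambda>(p, j). if p \<in> P then C $$ (\<phi> p, j) else 0)"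
  define D' where "D' = Matrix.mat k e (\<lambda>(j, q). if q \<in> Q then D $$ (j, \<psi> q) else 0)"
  have "select d e P Q \<phi> \<psi> X = C' * D'"
  proof (rule eq_matI)
    fix p q assume "p < dim_row (C' * D')" "q < dim_col (C' * D')"
    then have pq: "p < d" "q < e" by (auto simp: C'_def D'_def)
    have "(C * D) $$ (\<phi> p, \<psi> q) = (\<Sum>j<k. C $$ (\<phi> p, j) * D $$ (j, \<psi> q))"
      if "p \<in> P" "q \<in> Q"
    proof -
      have "\<phi> p < d'" "\<psi> q < e'" using that \<phi> \<psi> by auto
      then show ?thesis using C D by (simp add: scalar_prod_def atLeast0LessThan)
    qed
    then show "select d e P Q \<phi> \<psi> X $$ (p, q) = (C' * D') $$ (p, q)"
      using pq by (auto simp: select_index CD C'_def D'_def scalar_prod_def atLeast0LessThan)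
  qed (auto simp: C'_def D'_def select_def)
  moreover have "vec_space.rank d (C' * D') \<le> k"
    by (rule vec_space.rank_mult_le) (auto simp: C'_def D'_def)
  ultimately show ?thesis by (simp add: mat_rank_def k_def C'_def)
qed

section \<open>Spectral norm under selection\<close>

text \<open>The real supremum in \<open>spectral_norm\<close> is an upper bound only if the set is
  bounded. A crude bound is enough: coordinates of a vector in the unit ball have modulus at most 1,
  so the sum of the moduli of all entries of \<open>X\<close> works.\<close>

lemma eucl_norm_mult_bounded:
  "bdd_above ((\<lambda>v. eucl_norm (X *\<^sub>v v)) ` {v \<in> carrier_vec (dim_col X). eucl_norm v \<le> 1})"
proof (rule bdd_aboveI2)
  fix v assume "v \<in> {v \<in> carrier_vec (dim_col X). eucl_norm v \<le> 1}"
  then have v: "dim_vec v = dim_col X" "eucl_norm v \<le> 1" by auto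
  have comp: "cmod (v $ j) \<le> 1" if "j < dim_col X" for j
    using member_le_L2_set[of "{..<dim_vec v}" j "\<lambda>i. cmod (v $ i)"] that v
    by (simp add: eucl_norm_def)
  have "eucl_norm (X *\<^sub>v v) \<le> (\<Sum>i<dim_row X. cmod ((X *\<^sub>v v) $ i))"
    unfolding eucl_norm_def by (rule order_trans[OF L2_set_le_sum]) auto
  also have "\<dots> \<le> (\<Sum>i<dim_row X. \<Sum>j<dim_col X. cmod (X $$ (i, j)))"
  proof (rule sum_mono)
    fix i assume "i \<in> {..<dim_row X}"
    then have "(X *\<^sub>v v) $ i = (\<Sum>j<dim_col X. X $$ (i, j) * v $ j)"
      using v by (simp add: scalar_prod_def atLeast0LessThan)
    also have "cmod \<dots> \<le> (\<Sum>j<dim_col X. cmod (X $$ (i, j) * v $ j))" by (rule norm_sum)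
    also have "\<dots> \<le> (\<Sum>j<dim_col X. cmod (X $$ (i, j)))"
      by (rule sum_mono) (use comp in \<open>auto simp: norm_mult mult_left_le\<close>)
    finally show "cmod ((X *\<^sub>v v) $ i) \<le> (\<Sum>j<dim_col X. cmod (X $$ (i, j)))" .
  qed
  finally show "eucl_norm (X *\<^sub>v v) \<le> (\<Sum>i<dim_row X. \<Sum>j<dim_col X. cmod (X $$ (i, j)))" .
qed

lemma eucl_norm_mult_le_spectral_norm:
  assumes "v \<in> carrier_vec (dim_col X)" "eucl_norm v \<le> 1"
  shows "eucl_norm (X *\<^sub>v v) \<le> spectral_norm X"
  unfolding spectral_norm_def by (rule cSUP_upper[OF _ eucl_norm_mult_bounded]) (use assms in auto)

text \<open>Each vector \<open>v\<close> is transported along \<open>\<psi>\<close> to a vector \<open>w\<close> with \<open>\<parallel>w\<parallel> \<le> \<parallel>v\<parallel>\<close>, and the nonzero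
  entries of \<open>select \<dots> X v\<close> are distinct entries of \<open>X w\<close>.\<close>

lemma spectral_norm_select_le:
  assumes X: "X \<in> carrier_mat d' e'"
    and \<phi>: "\<phi> ` P \<subseteq> {..<d'}" "inj_on \<phi> P" and \<psi>: "\<psi> ` Q \<subseteq> {..<e'}" "inj_on \<psi> Q"
  shows "spectral_norm (select d e P Q \<phi> \<psi> X) \<le> spectral_norm X"
proof -
  let ?Y = "select d e P Q \<phi> \<psi> X"
  have "eucl_norm (?Y *\<^sub>v v) \<le> spectral_norm X"
    if "v \<in> {v \<in> carrier_vec (dim_col ?Y). eucl_norm v \<le> 1}" for v
  proof -
    have v: "dim_vec v = e" "eucl_norm v \<le> 1" using that by (auto simp: select_def)
    \<comment> \<open>\<open>P\<close> and \<open>Q\<close> may reach beyond the target dimensions;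
      cutting them down makes all sums finite.\<close>
    define Q' where "Q' = Q \<inter> {..<e}"
    define P' where "P' = P \<inter> {..<d}"
    have Q': "finite Q'" "inj_on \<psi> Q'" "\<psi> ` Q' \<subseteq> {..<e'}"
      using \<psi> by (auto simp: Q'_def inj_on_def)
    have P': "finite P'" "inj_on \<phi> P'" "\<phi> ` P' \<subseteq> {..<d'}"
      using \<phi> by (auto simp: P'_def inj_on_def)
    define w where
      "w = Matrix.vec e' (\<lambda>j. if j \<in> \<psi> ` Q' then v $ the_inv_into Q' \<psi> j else 0)"
    have w\<psi>: "w $ \<psi> q = v $ q" if "q \<in> Q'" for q
      using that Q' by (auto simp: w_def the_inv_into_f_f)
    have w0: "w $ j = 0" if "j < e'" "j \<notin> \<psi> ` Q'" for j
      using that by (simp add: w_def)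
    have dw: "dim_vec w = e'" by (simp add: w_def)
    have "(\<Sum>j<e'. (cmod (w $ j))\<^sup>2) = (\<Sum>j\<in>\<psi> ` Q'. (cmod (w $ j))\<^sup>2)"
      by (rule sum.mono_neutral_right) (use Q' w0 in auto)
    also have "\<dots> = (\<Sum>q\<in>Q'. (cmod (v $ q))\<^sup>2)"
      using Q' by (simp add: sum.reindex w\<psi>)
    also have "\<dots> \<le> (\<Sum>q<e. (cmod (v $ q))\<^sup>2)"
      by (rule sum_mono2) (auto simp: Q'_def)
    finally have "eucl_norm w \<le> eucl_norm v"
      by (simp add: eucl_norm_def L2_set_def dw v)
    with v have nw: "eucl_norm w \<le> 1" by simp
    have Yv: "(?Y *\<^sub>v v) $ p = (if p \<in> P' then (X *\<^sub>v w) $ \<phi> p else 0)" if p: "p < d" for p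
    proof -
      have "(?Y *\<^sub>v v) $ p = (\<Sum>q<e. ?Y $$ (p, q) * v $ q)"
        using p v by (simp add: scalar_prod_def atLeast0LessThan select_def)
      also have "\<dots> = (\<Sum>q\<in>Q'. if p \<in> P' then X $$ (\<phi> p, \<psi> q) * v $ q else 0)"
        by (rule sum.mono_neutral_cong_right)
          (use p in \<open>auto simp: Q'_def P'_def select_index\<close>)
      also have "\<dots> = (if p \<in> P' then (\<Sum>q\<in>Q'. X $$ (\<phi> p, \<psi> q) * w $ \<psi> q) else 0)"
        by (simp add: w\<psi>)
      also have "(\<Sum>q\<in>Q'. X $$ (\<phi> p, \<psi> q) * w $ \<psi> q) = (\<Sum>j\<in>\<psi> ` Q'. X $$ (\<phi> p, j) * w $ j)"
        using Q' by (simp add: sum.reindex)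
      also have "\<dots> = (\<Sum>j<e'. X $$ (\<phi> p, j) * w $ j)"
        by (rule sum.mono_neutral_left) (use Q' w0 in auto)
      also have "(if p \<in> P' then (\<Sum>j<e'. X $$ (\<phi> p, j) * w $ j) else 0)
          = (if p \<in> P' then (X *\<^sub>v w) $ \<phi> p else 0)"
        using X P' dw by (auto simp: scalar_prod_def atLeast0LessThan)
      finally show ?thesis .
    qed
    have "(\<Sum>p<d. (cmod ((?Y *\<^sub>v v) $ p))\<^sup>2) = (\<Sum>p\<in>P'. (cmod ((X *\<^sub>v w) $ \<phi> p))\<^sup>2)"
      by (rule sum.mono_neutral_cong_right) (auto simp: Yv P'_def simp del: index_mult_mat_vec)
    also have "\<dots> = (\<Sum>i\<in>\<phi> ` P'. (cmod ((X *\<^sub>v w) $ i))\<^sup>2)"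
      using P' by (simp add: sum.reindex)
    also have "\<dots> \<le> (\<Sum>i<d'. (cmod ((X *\<^sub>v w) $ i))\<^sup>2)"
      by (rule sum_mono2) (use P' in auto)
    finally have "eucl_norm (?Y *\<^sub>v v) \<le> eucl_norm (X *\<^sub>v w)"
      using X by (simp add: eucl_norm_def L2_set_def select_def del: index_mult_mat_vec)
    also have "\<dots> \<le> spectral_norm X"
      by (rule eucl_norm_mult_le_spectral_norm) (use X nw dw carrier_vecI in auto)
    finally show ?thesis .
  qed
  \<comment> \<open>\<open>cSUP_least\<close> needs a nonempty index set.\<close>
  moreover have "0\<^sub>v e \<in> {v \<in> carrier_vec (dim_col ?Y). eucl_norm v \<le> 1}"
    by (auto simp: select_def eucl_norm_def L2_set_def)
  ultimately show ?thesis
    unfolding spectral_norm_def[of ?Y] by (intro cSUP_least) blast+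
qed

section \<open>Multi-indices and block matrices\<close>

lemma indices_eq_PiE: "indices n = (\<Pi>\<^sub>E l\<in>UNIV. {1..n l})"
  by (auto simp: indices_def PiE_def Pi_def)

lemma finite_indices: "finite (indices (n :: 'd::finite \<Rightarrow> nat))"
  by (simp add: indices_eq_PiE finite_PiE)

lemma card_indices: "card (indices (n :: 'd::finite \<Rightarrow> nat)) = level_size n"
  by (simp add: indices_eq_PiE card_PiE level_size_def)

text \<open>By transitivity the predecessors of \<open>i\<close> are predecessors of
  \<open>j\<close>; strictness comes from \<open>i\<close> itself, which precedes \<open>j\<close>
  but not \<open>i\<close>.\<close>

lemma lex_pos_less:
  fixes n :: "'d::{finite,linorder} \<Rightarrow> nat"
  assumes "i \<in> indices n" "less_fun i j"
  shows "lex_pos n i < lex_pos n j"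
  unfolding lex_pos_def
proof (rule psubset_card_mono)
  show "finite {k \<in> indices n. less_fun k j}"
    by (rule finite_subset[OF _ finite_indices[of n]]) auto
  show "{k \<in> indices n. less_fun k i} \<subset> {k \<in> indices n. less_fun k j}"
    using assms less_fun_trans less_fun_irrefl by blast
qed

text \<open>Functions on a finite linear order are totally ordered lexicographically, so positions
  are injective; an index is not its own predecessor, so they stay below
  \<open>level_size n\<close>. Counting gives surjectivity, which makes \<open>lex_nth\<close> a
  genuine inverse.\<close>

lemma bij_betw_lex_pos:
  fixes n :: "'d::{finite,linorder} \<Rightarrow> nat"
  shows "bij_betw (lex_pos n) (indices n) {..<level_size n}"
proof -
  have inj: "inj_on (lex_pos n) (indices n)"
    by (rule inj_onI) (metis lex_pos_less less_fun_trichotomy finite less_irrefl)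
  have "lex_pos n i < level_size n" if "i \<in> indices n" for i
    unfolding lex_pos_def card_indices[symmetric]
    by (rule psubset_card_mono[OF finite_indices]) (use that less_fun_irrefl in blast)
  then have "lex_pos n ` indices n \<subseteq> {..<level_size n}" by auto
  moreover have "card (lex_pos n ` indices n) = card {..<level_size n}"
    by (simp add: card_image[OF inj] card_indices)
  ultimately show ?thesis
    using inj by (simp add: bij_betw_def card_subset_eq)
qed

lemma lex_pos_lex_nth:
  fixes n :: "'d::{finite,linorder} \<Rightarrow> nat"
  shows "k < level_size n \<Longrightarrow> lex_pos n (lex_nth n k) = k"
  unfolding lex_nth_def by (rule f_the_inv_into_f_bij_betw[OF bij_betw_lex_pos]) auto

lemma of_blocks_carrier [simp]:
  "of_blocks n r s x \<in> carrier_mat (level_size n * r) (level_size n * s)"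
  by (simp add: of_blocks_def)

lemma of_blocks_index:
  "p < level_size n * r \<Longrightarrow> q < level_size n * s \<Longrightarrow> of_blocks n r s x $$ (p, q)
    = x (lex_nth n (p div r)) (lex_nth n (q div s)) $$ (p mod r, q mod s)"
  by (simp add: of_blocks_def)

lemma mult_add_less:
  fixes k N r x :: nat
  assumes "k < N" "x < r"
  shows "k * r + x < N * r"
proof -
  have "k * r + x < (k + 1) * r" using assms by simp
  also have "\<dots> \<le> N * r" using assms by (intro mult_le_mono1) simp
  finally show ?thesis .
qed

lemma div_less_mod_less:
  fixes p N t :: nat
  assumes "p < N * t"
  shows "p div t < N" "p mod t < t"
proof -
  show "p div t < N" using assms by (rule less_mult_imp_div_less)
  have "0 < t" using assms by (cases t) auto
  then show "p mod t < t" by simp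
qed

lemma of_blocks_cong:
  assumes "\<And>k l x y. k < level_size n \<Longrightarrow> l < level_size n \<Longrightarrow> x < r \<Longrightarrow> y < s \<Longrightarrow>
    a (lex_nth n k) (lex_nth n l) $$ (x, y) = b (lex_nth n k) (lex_nth n l) $$ (x, y)"
  shows "of_blocks n r s a = of_blocks n r s b"
  using assms by (intro eq_matI) (auto simp: of_blocks_def div_less_mod_less)

lemma block_of_blocks:
  fixes n :: "'d::{finite,linorder} \<Rightarrow> nat"
  assumes "k < level_size n" "l < level_size n" "x < r" "y < s"
  shows "block n r s (of_blocks n r s a) (lex_nth n k) (lex_nth n l) $$ (x, y)
    = a (lex_nth n k) (lex_nth n l) $$ (x, y)"
  using assms by (simp add: block_def of_blocks_index lex_pos_lex_nth mult_add_less)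

text \<open>The left factor is diagonal with scalar blocks, so it only rescales block rows. With the
  product gone, a selection can be applied block by block.\<close>

lemma sampling_mult_toeplitz:
  fixes n :: "'d::{finite,linorder} \<Rightarrow> nat"
  shows "sampling n s s (\<lambda>x. a x \<cdot>\<^sub>m 1\<^sub>m s) * toeplitz n s s f
    = of_blocks n s s (\<lambda>i j. a (\<chi> l. real (i l) / real (n l))
        \<cdot>\<^sub>m fourier_coeff s s f (\<lambda>l. int (i l) - int (j l)))"
    (is "?D * ?T = ?B")
proof (rule eq_matI)
  let ?N = "level_size n * s"
  fix p q assume "p < dim_row ?B" "q < dim_col ?B"
  then have pq: "p < ?N" "q < ?N" by (auto simp: of_blocks_def)
  let ?a = "a (\<chi> l. real (lex_nth n (p div s) l) / real (n l))"
  have D: "?D \<in> carrier_mat ?N ?N" and T: "?T \<in> carrier_mat ?N ?N"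
    by (simp_all add: sampling_def toeplitz_def)
  have entry: "?D $$ (p, k) = (if k = p then ?a else 0)" if k: "k < ?N" for k
  proof -
    \<comment> \<open>\<open>sampling\<close> tests equality of multi-indices, the diagonal is about
      positions; injectivity of \<open>lex_nth\<close> on valid positions links the two.\<close>
    have "lex_nth n (p div s) = lex_nth n (k div s) \<longleftrightarrow> p div s = k div s"
      by (metis div_less_mod_less(1) k lex_pos_lex_nth pq(1))
    moreover have "k = p \<longleftrightarrow> p div s = k div s \<and> p mod s = k mod s"
      by (metis div_mult_mod_eq)
    ultimately show ?thesis
      using pq k by (auto simp: sampling_def of_blocks_index div_less_mod_less)
  qed
  have "(?D * ?T) $$ (p, q) = (\<Sum>k<?N. ?D $$ (p, k) * ?T $$ (k, q))"
    using D T pq by (simp add: scalar_prod_def atLeast0LessThan)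
  also have "\<dots> = (\<Sum>k<?N. if k = p then ?a * ?T $$ (p, q) else 0)"
    by (rule sum.cong) (auto simp: entry)
  also have "\<dots> = ?a * ?T $$ (p, q)" using pq by simp
  also have "\<dots> = ?B $$ (p, q)"
    using pq by (simp add: toeplitz_def of_blocks_index div_less_mod_less fourier_coeff_def)
  finally show "(?D * ?T) $$ (p, q) = ?B $$ (p, q)" .
qed (auto simp: sampling_def toeplitz_def of_blocks_def)

section \<open>Selection inside the blocks of a GLT sequence\<close>

locale block_selection =
  fixes t T :: nat and P Q :: "nat set" and \<phi> \<psi> :: "nat \<Rightarrow> nat"
  assumes P: "P \<subseteq> {..<t}" and Q: "Q \<subseteq> {..<t}"
    and \<phi>: "\<phi> ` P \<subseteq> {..<T}" "inj_on \<phi> P"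
    and \<psi>: "\<psi> ` Q \<subseteq> {..<T}" "inj_on \<psi> Q"
begin

abbreviation sel :: "complex mat \<Rightarrow> complex mat" where
  "sel \<equiv> select t t P Q \<phi> \<psi>"

text \<open>Position \<open>p\<close> is offset \<open>p mod t\<close> in block
  \<open>p div t\<close>. The block number is kept and only the offset is moved, into blocks of size
  \<open>T\<close>; in Kronecker form the outer factors are identity tensor L and identity tensor
  R.\<close>

definition sel_blocks :: "('d::finite \<Rightarrow> nat) \<Rightarrow> complex mat \<Rightarrow> complex mat" where
  "sel_blocks n = select (level_size n * t) (level_size n * t)
     {p. p < level_size n * t \<and> p mod t \<in> P} {q. q < level_size n * t \<and> q mod t \<in> Q}
     (\<lambda>p. p div t * T + \<phi> (p mod t)) (\<lambda>q. q div t * T + \<psi> (q mod t))"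

text \<open>Since the new offset is below \<open>T\<close>, division by \<open>T\<close> recovers
  the block number, and injectivity of \<open>f\<close> then recovers the old offset.\<close>

lemma lifted_selection:
  assumes "S \<subseteq> {..<t}" "f ` S \<subseteq> {..<T}" "inj_on f S"
  shows "(\<lambda>p. p div t * T + f (p mod t)) ` {p. p < N * t \<and> p mod t \<in> S} \<subseteq> {..<N * T}"
    and "inj_on (\<lambda>p. p div t * T + f (p mod t)) {p. p < N * t \<and> p mod t \<in> S}"
proof -
  show "(\<lambda>p. p div t * T + f (p mod t)) ` {p. p < N * t \<and> p mod t \<in> S} \<subseteq> {..<N * T}"
    using assms(2) by (auto intro!: mult_add_less dest: div_less_mod_less(1))
  show "inj_on (\<lambda>p. p div t * T + f (p mod t)) {p. p < N * t \<and> p mod t \<in> S}"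
  proof (rule inj_onI)
    fix p q
    assume p: "p \<in> {p. p < N * t \<and> p mod t \<in> S}" and q: "q \<in> {p. p < N * t \<and> p mod t \<in> S}"
      and eq: "p div t * T + f (p mod t) = q div t * T + f (q mod t)"
    have lt: "f (p mod t) < T" "f (q mod t) < T" using p q assms(2) by auto
    have "(p div t * T + f (p mod t)) div T = p div t" "(q div t * T + f (q mod t)) div T = q div t"
      using lt by simp_all
    with eq have "p div t = q div t" by simp
    moreover from this eq have "p mod t = q mod t"
      using p q assms(3) by (auto dest: inj_onD)
    ultimately show "p = q" by (metis div_mult_mod_eq)
  qed
qed

lemmas lifted_\<phi> = lifted_selection[OF P \<phi>]
lemmas lifted_\<psi> = lifted_selection[OF Q \<psi>]

lemma sel_blocks_carrier [simp]:
  "sel_blocks n X \<in> carrier_mat (level_size n * t) (level_size n * t)"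
  by (simp add: sel_blocks_def)

lemma sel_blocks_of_blocks:
  "sel_blocks n (of_blocks n T T x) = of_blocks n t t (\<lambda>i j. sel (x i j))"
proof (rule eq_matI)
  fix p q
  assume "p < dim_row (of_blocks n t t (\<lambda>i j. sel (x i j)))"
    "q < dim_col (of_blocks n t t (\<lambda>i j. sel (x i j)))"
  then have pq: "p < level_size n * t" "q < level_size n * t" by (auto simp: of_blocks_def)
  show "sel_blocks n (of_blocks n T T x) $$ (p, q) = of_blocks n t t (\<lambda>i j. sel (x i j)) $$ (p, q)"
  proof (cases "p mod t \<in> P \<and> q mod t \<in> Q")
    case True
    then have "\<phi> (p mod t) < T" "\<psi> (q mod t) < T" using \<phi> \<psi> by auto
    then show ?thesis using True pq
      by (simp add: sel_blocks_def select_index of_blocks_index mult_add_less div_less_mod_less)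
  next
    case False
    then show ?thesis using pq
      by (auto simp: sel_blocks_def select_index of_blocks_index div_less_mod_less)
  qed
qed (auto simp: sel_blocks_def select_def of_blocks_def)

lemma fourier_coeff_sel:
  "fourier_coeff t t (\<lambda>\<theta>. sel (f \<theta>)) k = sel (fourier_coeff T T f k)"
proof (rule eq_matI)
  fix x y assume "x < dim_row (sel (fourier_coeff T T f k))" "y < dim_col (sel (fourier_coeff T T f k))"
  then have xy: "x < t" "y < t" by (auto simp: select_def)
  show "fourier_coeff t t (\<lambda>\<theta>. sel (f \<theta>)) k $$ (x, y) = sel (fourier_coeff T T f k) $$ (x, y)"
  proof (cases "x \<in> P \<and> y \<in> Q")
    case True
    then have "\<phi> x < T" "\<psi> y < T" using \<phi> \<psi> by auto
    then show ?thesis using True xy by (simp add: fourier_coeff_def select_index)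
  next
    case False
    then show ?thesis using xy by (auto simp: fourier_coeff_def select_index)
  qed
qed (auto simp: fourier_coeff_def select_def)

lemma sel_smult:
  assumes "X \<in> carrier_mat T T"
  shows "sel (c \<cdot>\<^sub>m X) = c \<cdot>\<^sub>m sel X"
  using assms \<phi>(1) \<psi>(1) by (intro eq_matI) (auto simp: select_def image_subset_iff)

text \<open>A monomial whose matrix unit is not selected must still be replaced by a monomial, so its
  coefficient function is set to zero instead.\<close>

lemma select_term:
  fixes a :: "'d::finite point \<Rightarrow> complex" and f :: "'d point \<Rightarrow> complex mat"
  assumes a: "smooth_on_cube a" and f: "f \<in> trig_monomials T" and t: "0 < t"
  obtains a' f' where "smooth_on_cube a'" "f' \<in> trig_monomials t"
    "(a' = a \<and> f' = (\<lambda>\<theta>. sel (f \<theta>))) \<or> (a' = (\<lambda>_. 0) \<and> (\<forall>\<theta>. sel (f \<theta>) = 0\<^sub>m t t))"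
proof -
  obtain k \<alpha> \<beta> where \<alpha>\<beta>: "\<alpha> < T" "\<beta> < T"
    and f_eq: "f = (\<lambda>\<theta>. exp (\<i> * of_real (dot k \<theta>)) \<cdot>\<^sub>m unit_matrix T \<alpha> \<beta>)"
    using f by (auto simp: trig_monomials_def)
  show thesis
  proof (cases "\<alpha> \<in> \<phi> ` P \<and> \<beta> \<in> \<psi> ` Q")
    case True
    \<comment> \<open>Injectivity makes \<open>x\<close> and \<open>y\<close> the only preimages, so
      exactly one matrix unit survives.\<close>
    then obtain x y where xy: "x \<in> P" "\<phi> x = \<alpha>" "y \<in> Q" "\<psi> y = \<beta>" by auto
    have "sel (f \<theta>) = exp (\<i> * of_real (dot k \<theta>)) \<cdot>\<^sub>m unit_matrix t x y" for \<theta>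
    proof (rule eq_matI)
      fix u v assume "u < dim_row (exp (\<i> * of_real (dot k \<theta>)) \<cdot>\<^sub>m unit_matrix t x y)"
        "v < dim_col (exp (\<i> * of_real (dot k \<theta>)) \<cdot>\<^sub>m unit_matrix t x y)"
      then have uv: "u < t" "v < t" by (auto simp: unit_matrix_def)
      have "\<phi> u < T \<and> (\<phi> u = \<alpha> \<longleftrightarrow> u = x)" if "u \<in> P"
        using that xy \<phi> by (auto dest: inj_onD)
      moreover have "\<psi> v < T \<and> (\<psi> v = \<beta> \<longleftrightarrow> v = y)" if "v \<in> Q"
        using that xy \<psi> by (auto dest: inj_onD)
      ultimately show "sel (f \<theta>) $$ (u, v)
          = (exp (\<i> * of_real (dot k \<theta>)) \<cdot>\<^sub>m unit_matrix t x y) $$ (u, v)"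
        using uv xy by (auto simp: select_index f_eq unit_matrix_def)
    qed (auto simp: select_def unit_matrix_def)
    moreover have "x < t" "y < t" using xy P Q by auto
    ultimately have "(\<lambda>\<theta>. sel (f \<theta>)) \<in> trig_monomials t"
      by (auto simp: trig_monomials_def)
    with a show thesis by (intro that) auto
  next
    case False
    have smooth0: "times_cont_differentiable_on j UNIV (\<lambda>_ :: 'd point. 0 :: complex)" for j
      by (induction j) auto
    have sel0: "sel (f \<theta>) = 0\<^sub>m t t" for \<theta>
    proof (rule eq_matI)
      fix u v assume "u < dim_row (0\<^sub>m t t)" "v < dim_col (0\<^sub>m t t)"
      then have uv: "u < t" "v < t" by auto
      show "sel (f \<theta>) $$ (u, v) = 0\<^sub>m t t $$ (u, v)"
      proof (cases "u \<in> P \<and> v \<in> Q")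
        case True
        then have "\<phi> u < T" "\<psi> v < T" "\<not> (\<phi> u = \<alpha> \<and> \<psi> v = \<beta>)" using \<phi> \<psi> False by auto
        then show ?thesis using uv by (auto simp: select_index f_eq unit_matrix_def)
      qed (use uv in \<open>auto simp: select_index\<close>)
    qed (auto simp: select_def)
    have "smooth_on_cube (\<lambda>_ :: 'd point. 0)"
      unfolding smooth_on_cube_def using smooth0 by blast
    \<comment> \<open>Any monomial would serve next to a zero coefficient; \<open>0 < t\<close>
      provides the matrix unit at position (0, 0).\<close>
    moreover have "(\<lambda>\<theta> :: 'd point. exp (\<i> * of_real (dot (\<lambda>_. 0) \<theta>)) \<cdot>\<^sub>m unit_matrix t 0 0) \<in> trig_monomials t"
      using t unfolding trig_monomials_def by blast
    ultimately show thesis by (rule that) (simp add: sel0)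
  qed
qed

text \<open>Selection is additive, so the splitting of \<open>A n\<close> is mapped summand by
  summand. The thresholds \<open>n0\<close> and the norm bounds \<open>\<omega>\<close> are kept;
  only the rank constants change.\<close>

lemma acs_sel_blocks:
  assumes "acs K (\<lambda>n. level_size (\<nu> n) * T) (\<lambda>n. level_size (\<nu> n) * T) B A"
  shows "acs K (\<lambda>n. level_size (\<nu> n) * t) (\<lambda>n. level_size (\<nu> n) * t)
    (\<lambda>n m. sel_blocks (\<nu> n) (B n m)) (\<lambda>n. sel_blocks (\<nu> n) (A n))"
proof -
  obtain n0 c \<omega> where lim: "c \<longlonglongrightarrow> 0" "\<omega> \<longlonglongrightarrow> 0"
    and dec: "\<And>m n. n \<in> K \<Longrightarrow> n0 m \<le> n \<Longrightarrow> \<exists>R N.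
      R \<in> carrier_mat (level_size (\<nu> n) * T) (level_size (\<nu> n) * T) \<and>
      N \<in> carrier_mat (level_size (\<nu> n) * T) (level_size (\<nu> n) * T) \<and>
      A n = B n m + R + N \<and>
      real (mat_rank R) \<le> c m * real (min (level_size (\<nu> n) * T) (level_size (\<nu> n) * T)) \<and>
      spectral_norm N \<le> \<omega> m"
    using assms unfolding acs_def by blast
  have B: "B n m \<in> carrier_mat (level_size (\<nu> n) * T) (level_size (\<nu> n) * T)" if "n \<in> K" for n m
    using assms that unfolding acs_def by blast
  \<comment> \<open>The factor converts a fraction of the order
    \<open>level_size (\<nu> n) * T\<close> into one of
    \<open>level_size (\<nu> n) * t\<close>.\<close>
  define c' where "c' m = c m * (real T / real t)" for m
  have c': "c' \<longlonglongrightarrow> 0" unfolding c'_def by (rule tendsto_mult_left_zero[OF lim(1)])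
  have "\<exists>R N. R \<in> carrier_mat (level_size (\<nu> n) * t) (level_size (\<nu> n) * t) \<and>
      N \<in> carrier_mat (level_size (\<nu> n) * t) (level_size (\<nu> n) * t) \<and>
      sel_blocks (\<nu> n) (A n) = sel_blocks (\<nu> n) (B n m) + R + N \<and>
      real (mat_rank R) \<le> c' m * real (min (level_size (\<nu> n) * t) (level_size (\<nu> n) * t)) \<and>
      spectral_norm N \<le> \<omega> m"
    if n: "n \<in> K" "n0 m \<le> n" for n m
  proof -
    let ?d = "level_size (\<nu> n) * T"
    obtain R N where R: "R \<in> carrier_mat ?d ?d" and N: "N \<in> carrier_mat ?d ?d"
      and A_eq: "A n = B n m + R + N" and rk: "real (mat_rank R) \<le> c m * real ?d"
      and nrm: "spectral_norm N \<le> \<omega> m"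
      using dec[OF n] by auto
    let ?R = "sel_blocks (\<nu> n) R" and ?N = "sel_blocks (\<nu> n) N"
    have "sel_blocks (\<nu> n) (A n) = sel_blocks (\<nu> n) (B n m) + ?R + ?N"
      unfolding A_eq sel_blocks_def
      by (subst select_add[OF _ _ lifted_\<phi>(1) lifted_\<psi>(1)] | use B[OF n(1)] R N in force)+
    moreover have "spectral_norm ?N \<le> \<omega> m"
      unfolding sel_blocks_def
      by (rule order_trans[OF spectral_norm_select_le[OF N lifted_\<phi> lifted_\<psi>] nrm])
    moreover have "real (mat_rank ?R) \<le> c' m * real (level_size (\<nu> n) * t)"
    \<comment> \<open>For \<open>t = 0\<close> the quotient is no conversion factor, but the matrix
      has no columns and hence rank 0.\<close>
    proof (cases "t = 0")
      case True
      then have "mat_rank ?R \<le> 0"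
        unfolding mat_rank_def
        by (intro vec_space.rank_le_nc) (use sel_blocks_carrier[of "\<nu> n" R] in auto)
      with True show ?thesis by simp
    next
      case False
      have "mat_rank ?R \<le> mat_rank R"
        unfolding sel_blocks_def by (rule mat_rank_select_le[OF R lifted_\<phi>(1) lifted_\<psi>(1)])
      with rk have "real (mat_rank ?R) \<le> c m * real ?d" by linarith
      also have "\<dots> = c' m * real (level_size (\<nu> n) * t)"
        using False by (simp add: c'_def)
      finally show ?thesis .
    qed
    ultimately show ?thesis
      by (intro exI[of _ ?R] exI[of _ ?N]) simp
  qed
  then show ?thesis
    unfolding acs_def using c' lim(2) by (intro conjI exI[of _ n0] exI[of _ c'] exI[of _ \<omega>]) auto
qed

lemma measurable_symbol_sel:
  assumes "measurable_symbol T T \<kappa>"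
  shows "measurable_symbol t t (\<lambda>z. sel (\<kappa> z))"
proof -
  have "(\<lambda>z. sel (\<kappa> z) $$ (x, y)) \<in> borel_measurable (lebesgue_on (unit_cube \<times> freq_cube))"
    if "x < t" "y < t" for x y
  proof (cases "x \<in> P \<and> y \<in> Q")
    case True
    then have "\<phi> x < T" "\<psi> y < T" using \<phi> \<psi> by auto
    then show ?thesis using assms True that by (simp add: select_index measurable_symbol_def)
  next
    case False
    then have "(\<lambda>z. sel (\<kappa> z) $$ (x, y)) = (\<lambda>_. 0)" using that by (auto simp: select_index)
    then show ?thesis by simp
  qed
  then show ?thesis by (simp add: measurable_symbol_def)
qed

lemma square_glt_sel:
  assumes "square_glt K \<nu> T A \<kappa>"
  shows "square_glt K \<nu> t (\<lambda>n. sel_blocks (\<nu> n) (A n)) (\<lambda>z. sel (\<kappa> z))"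
proof -
  let ?d = "\<lambda>n. level_size (\<nu> n) * T" and ?d' = "\<lambda>n. level_size (\<nu> n) * t"
  obtain M :: "nat \<Rightarrow> nat" and a f where "\<forall>m. \<forall>i<M m. smooth_on_cube (a m i) \<and> f m i \<in> trig_monomials T"
    and AE: "AE z in lebesgue_on (unit_cube \<times> freq_cube). \<forall>\<alpha><T. \<forall>\<beta><T.
      (\<lambda>m. mat_sum T T (\<lambda>i. a m i (fst z) \<cdot>\<^sub>m f m i (snd z)) {..<M m} $$ (\<alpha>, \<beta>))
        \<longlonglongrightarrow> \<kappa> z $$ (\<alpha>, \<beta>)"
    and acs: "acs K ?d ?d (\<lambda>n m. mat_sum (?d n) (?d n)
      (\<lambda>i. sampling (\<nu> n) T T (\<lambda>x. a m i x \<cdot>\<^sub>m 1\<^sub>m T) * toeplitz (\<nu> n) T T (f m i)) {..<M m}) A"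
    using assms unfolding square_glt_def by (elim conjE exE) (rule that, assumption+)
  then have af: "i < M m \<Longrightarrow> smooth_on_cube (a m i) \<and> f m i \<in> trig_monomials T" for m i
    by blast
  \<comment> \<open>There is no monomial of size \<open>0\<close> that could replace the deleted terms.\<close>
  define M' where "M' m = (if t = 0 then 0 else M m)" for m
  define replaces where "replaces m i a' f' \<longleftrightarrow> smooth_on_cube a' \<and> f' \<in> trig_monomials t \<and>
      ((a' = a m i \<and> f' = (\<lambda>\<theta>. sel (f m i \<theta>))) \<or>
       (a' = (\<lambda>_. 0) \<and> (\<forall>\<theta>. sel (f m i \<theta>) = 0\<^sub>m t t)))" for m i a' f'
  have "\<exists>a' f'. replaces m i a' f'" if "i < M' m" for m i
  proof -
    have i: "0 < t" "i < M m" using that by (auto simp: M'_def split: if_splits)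
    with af have "smooth_on_cube (a m i)" "f m i \<in> trig_monomials T" by blast+
    from select_term[OF this i(1)] show ?thesis unfolding replaces_def by blast
  qed
  \<comment> \<open>The bound on \<open>i\<close> moves inside the existential so that choice yields
    one total function of \<open>m\<close> and \<open>i\<close>.\<close>
  then have "\<forall>m i. \<exists>p. i < M' m \<longrightarrow> replaces m i (fst p) (snd p)"
    by simp
  then obtain F where F: "\<And>m i. i < M' m \<Longrightarrow> replaces m i (fst (F m i)) (snd (F m i))"
    unfolding choice_iff by blast
  define a' where "a' m i = fst (F m i)" for m i
  define f' where "f' m i = snd (F m i)" for m i
  note af' = F[folded a'_def f'_def, unfolded replaces_def]
  have f_carrier: "f m i \<theta> \<in> carrier_mat T T" if "i < M m" for m i \<theta>
    using af[OF that] by (auto simp: trig_monomials_def unit_matrix_def)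
  have f'_carrier: "f' m i \<theta> \<in> carrier_mat t t" if "i < M' m" for m i \<theta>
    using af'[OF that] by (auto simp: trig_monomials_def unit_matrix_def)
  have M'M: "i < M m" if "i < M' m" for i m using that by (auto simp: M'_def split: if_splits)
  have pointwise: "a' m i x \<cdot>\<^sub>m f' m i \<theta> = sel (a m i x \<cdot>\<^sub>m f m i \<theta>)" if "i < M' m" for m i x \<theta>
  proof -
    have "0 \<cdot>\<^sub>m f' m i \<theta> = 0\<^sub>m t t" "c \<cdot>\<^sub>m 0\<^sub>m t t = 0\<^sub>m t t" for c :: complex
      using f'_carrier[OF that, of \<theta>] by (auto intro!: eq_matI)
    then show ?thesis
      using af'[OF that] by (auto simp: sel_smult[OF f_carrier[OF M'M[OF that]]])
  qed
  \<comment> \<open>The counterpart of \<open>pointwise\<close> for Fourier coefficients: that one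
    carries over the a.e. convergence of the symbols, this one the identity of the matrices.\<close>
  have coeff: "a' m i x \<cdot>\<^sub>m fourier_coeff t t (f' m i) k = sel (a m i x \<cdot>\<^sub>m fourier_coeff T T (f m i) k)"
    if i: "i < M' m" for m i x k
  proof -
    have "sel (fourier_coeff T T (f m i) k) = 0\<^sub>m t t" if "\<forall>\<theta>. sel (f m i \<theta>) = 0\<^sub>m t t"
      unfolding fourier_coeff_sel[symmetric] using that by (auto intro!: eq_matI simp: fourier_coeff_def)
    moreover have "fourier_coeff T T (f m i) k \<in> carrier_mat T T"
      "fourier_coeff t t (f' m i) k \<in> carrier_mat t t"
      by (simp_all add: fourier_coeff_def)
    ultimately show ?thesis
      using af'[OF i] by (auto simp: sel_smult fourier_coeff_sel intro!: eq_matI)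
  qed
  have sum_eq: "mat_sum (?d' n) (?d' n)
        (\<lambda>i. sampling (\<nu> n) t t (\<lambda>x. a' m i x \<cdot>\<^sub>m 1\<^sub>m t) * toeplitz (\<nu> n) t t (f' m i)) {..<M' m}
      = sel_blocks (\<nu> n) (mat_sum (?d n) (?d n)
          (\<lambda>i. sampling (\<nu> n) T T (\<lambda>x. a m i x \<cdot>\<^sub>m 1\<^sub>m T) * toeplitz (\<nu> n) T T (f m i)) {..<M m})"
    (is "?L = _") for n m
  proof -
    have "?L = mat_sum (?d' n) (?d' n) (\<lambda>i. sel_blocks (\<nu> n)
        (sampling (\<nu> n) T T (\<lambda>x. a m i x \<cdot>\<^sub>m 1\<^sub>m T) * toeplitz (\<nu> n) T T (f m i))) {..<M' m}"
      by (rule mat_sum_cong) (simp add: sampling_mult_toeplitz sel_blocks_of_blocks coeff)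
    also have "\<dots> = mat_sum (?d' n) (?d' n) (\<lambda>i. sel_blocks (\<nu> n)
        (sampling (\<nu> n) T T (\<lambda>x. a m i x \<cdot>\<^sub>m 1\<^sub>m T) * toeplitz (\<nu> n) T T (f m i))) {..<M m}"
      \<comment> \<open>\<open>M'\<close> and \<open>M\<close> differ only for \<open>t = 0\<close>,
        when both sides are empty matrices.\<close>
      by (rule eq_matI) (auto simp: M'_def mat_sum_def)
    also have "\<dots> = sel_blocks (\<nu> n) (mat_sum (?d n) (?d n)
        (\<lambda>i. sampling (\<nu> n) T T (\<lambda>x. a m i x \<cdot>\<^sub>m 1\<^sub>m T) * toeplitz (\<nu> n) T T (f m i)) {..<M m})"
      unfolding sel_blocks_def by (rule select_mat_sum[OF lifted_\<phi>(1) lifted_\<psi>(1), symmetric])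
    finally show ?thesis .
  qed
  have "AE z in lebesgue_on (unit_cube \<times> freq_cube). \<forall>x<t. \<forall>y<t.
      (\<lambda>m. mat_sum t t (\<lambda>i. a' m i (fst z) \<cdot>\<^sub>m f' m i (snd z)) {..<M' m} $$ (x, y))
        \<longlonglongrightarrow> sel (\<kappa> z) $$ (x, y)"
    using AE
  proof eventually_elim
    case (elim z)
    show ?case
    proof (intro allI impI)
      fix x y assume xy: "x < t" "y < t"
      have "mat_sum t t (\<lambda>i. a' m i (fst z) \<cdot>\<^sub>m f' m i (snd z)) {..<M' m}
          = sel (mat_sum T T (\<lambda>i. a m i (fst z) \<cdot>\<^sub>m f m i (snd z)) {..<M m})" for m
      proof -
        have "mat_sum t t (\<lambda>i. a' m i (fst z) \<cdot>\<^sub>m f' m i (snd z)) {..<M' m}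
            = mat_sum t t (\<lambda>i. sel (a m i (fst z) \<cdot>\<^sub>m f m i (snd z))) {..<M' m}"
          by (rule mat_sum_cong) (simp add: pointwise)
        then show ?thesis using xy by (simp add: select_mat_sum[OF \<phi>(1) \<psi>(1)] M'_def)
      qed
      then have eq: "mat_sum t t (\<lambda>i. a' m i (fst z) \<cdot>\<^sub>m f' m i (snd z)) {..<M' m} $$ (x, y)
          = (if x \<in> P \<and> y \<in> Q
             then mat_sum T T (\<lambda>i. a m i (fst z) \<cdot>\<^sub>m f m i (snd z)) {..<M m} $$ (\<phi> x, \<psi> y) else 0)" for m
        using xy by (simp add: select_index)
      have "\<phi> x < T" if "x \<in> P" using that \<phi> by auto
      moreover have "\<psi> y < T" if "y \<in> Q" using that \<psi> by auto
      ultimately show "(\<lambda>m. mat_sum t t (\<lambda>i. a' m i (fst z) \<cdot>\<^sub>m f' m i (snd z)) {..<M' m} $$ (x, y))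
          \<longlonglongrightarrow> sel (\<kappa> z) $$ (x, y)"
        unfolding eq using elim xy by (cases "x \<in> P \<and> y \<in> Q") (auto simp: select_index)
    qed
  qed
  moreover have "block_matrix_seq K \<nu> t t (\<lambda>n. sel_blocks (\<nu> n) (A n))"
    using assms by (simp add: square_glt_def block_matrix_seq_def)
  moreover have "measurable_symbol t t (\<lambda>z. sel (\<kappa> z))"
    by (rule measurable_symbol_sel) (use assms in \<open>simp add: square_glt_def\<close>)
  moreover have "acs K ?d' ?d' (\<lambda>n m. mat_sum (?d' n) (?d' n)
      (\<lambda>i. sampling (\<nu> n) t t (\<lambda>x. a' m i x \<cdot>\<^sub>m 1\<^sub>m t) * toeplitz (\<nu> n) t t (f' m i)) {..<M' m})
      (\<lambda>n. sel_blocks (\<nu> n) (A n))"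
    unfolding sum_eq by (rule acs_sel_blocks[OF acs])
  ultimately show ?thesis
    unfolding square_glt_def using af' by blast
qed

end

section \<open>From padded square sequences back to submatrices of rectangular blocks\<close>

text \<open>The two descriptions of the new symbol agree only where \<open>\<kappa> z\<close> has
  size \<open>r\<close> by \<open>s\<close>, which is guaranteed on the cube alone.\<close>

lemma square_glt_symbol_cong:
  assumes "square_glt K \<nu> s A \<kappa>" and "\<And>z. z \<in> unit_cube \<times> freq_cube \<Longrightarrow> \<kappa>' z = \<kappa> z"
  shows "square_glt K \<nu> s A \<kappa>'"
proof -
  let ?L = "lebesgue_on (unit_cube \<times> freq_cube) :: ('a point \<times> 'a point) measure"
  have eq: "\<kappa>' z = \<kappa> z" if "z \<in> space ?L" for z
    using that by (intro assms(2)) simp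
  have "(\<lambda>z. \<kappa>' z $$ p) \<in> borel_measurable ?L \<longleftrightarrow> (\<lambda>z. \<kappa> z $$ p) \<in> borel_measurable ?L" for p
    by (rule measurable_cong) (use eq in simp)
  then have "measurable_symbol s s \<kappa>'"
    using assms unfolding square_glt_def measurable_symbol_def by simp
  moreover have "(AE z in ?L. \<forall>\<alpha><s. \<forall>\<beta><s. (\<lambda>m. g m z $$ (\<alpha>, \<beta>)) \<longlonglongrightarrow> \<kappa>' z $$ (\<alpha>, \<beta>)) \<longleftrightarrow>
      (AE z in ?L. \<forall>\<alpha><s. \<forall>\<beta><s. (\<lambda>m. g m z $$ (\<alpha>, \<beta>)) \<longlonglongrightarrow> \<kappa> z $$ (\<alpha>, \<beta>))"
    for g :: "nat \<Rightarrow> 'a point \<times> 'a point \<Rightarrow> complex mat"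
    by (rule AE_cong) (simp add: eq)
  ultimately show ?thesis
    using assms(1) unfolding square_glt_def by simp
qed

theorem theorem4p10:
  fixes K :: "nat set"
    and \<nu> :: "nat \<Rightarrow> 'd::{finite,linorder} \<Rightarrow> nat"
    and A :: "nat \<Rightarrow> complex mat"
    and \<kappa> :: "'d point \<times> 'd point \<Rightarrow> complex mat"
    and r s r' s' :: nat
    and I J :: "nat set"
  assumes "glt K \<nu> r s A \<kappa>"
    and "I \<subseteq> {..<r}" and "card I = r'"
    and "J \<subseteq> {..<s}" and "card J = s'"
  shows "glt K \<nu> r' s'
           (\<lambda>n. of_blocks (\<nu> n) r' s' (\<lambda>i j. submatrix (block (\<nu> n) r s (A n) i j) I J))
           (\<lambda>z. submatrix (\<kappa> z) I J)"
proof -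
  let ?A = "\<lambda>n. of_blocks (\<nu> n) r' s' (\<lambda>i j. submatrix (block (\<nu> n) r s (A n) i j) I J)"
  define T where "T = max r s"
  have glt: "block_matrix_seq K \<nu> r s A" "measurable_symbol r s \<kappa>"
    "square_glt K \<nu> T (\<lambda>n. extend_blocks (\<nu> n) r s T (A n)) (\<lambda>z. extend r s T (\<kappa> z))"
    using assms(1) by (auto simp: glt_def T_def)
  have I: "pick I x < r" if "x < r'" for x
    using pick_in_set_le[of x I] that assms by auto
  have J: "pick J y < s" if "y < s'" for y
    using pick_in_set_le[of y J] that assms by auto
  have "{i. i < r \<and> i \<in> I} = I" "{j. j < s \<and> j \<in> J} = J" using assms by auto
  then have sub: "submatrix X I J = Matrix.mat r' s' (\<lambda>(x, y). X $$ (pick I x, pick J y))"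
    if "X \<in> carrier_mat r s" for X :: "complex mat"
    using that assms by (auto simp: submatrix_def)
  \<comment> \<open>\<open>pick S\<close> enumerates \<open>S\<close> in strictly increasing
    order.\<close>
  have inj: "inj_on (pick S) {..<card S}" for S
    by (rule inj_onI) (metis lessThan_iff linorder_neqE_nat less_irrefl pick_mono_le)
  have "measurable_symbol r' s' (\<lambda>z. submatrix (\<kappa> z) I J)"
    unfolding measurable_symbol_def
  proof (intro conjI ballI allI impI)
    fix z :: "'d point \<times> 'd point"
    assume "z \<in> unit_cube \<times> freq_cube"
    then show "submatrix (\<kappa> z) I J \<in> carrier_mat r' s'"
      using glt(2) by (subst sub) (auto simp: measurable_symbol_def)
  next
    fix x y assume xy: "x < r'" "y < s'"
    have "(\<lambda>z. \<kappa> z $$ (pick I x, pick J y)) \<in> borel_measurable (lebesgue_on (unit_cube \<times> freq_cube))"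
      using glt(2) I J xy by (simp add: measurable_symbol_def)
    moreover have *: "submatrix (\<kappa> z) I J $$ (x, y) = \<kappa> z $$ (pick I x, pick J y)"
      if "z \<in> space (lebesgue_on (unit_cube \<times> freq_cube))" for z
      using glt(2) that xy by (subst sub) (auto simp: measurable_symbol_def)
    ultimately show "(\<lambda>z. submatrix (\<kappa> z) I J $$ (x, y))
        \<in> borel_measurable (lebesgue_on (unit_cube \<times> freq_cube))"
      by (subst measurable_cong[OF *])
  qed
  moreover have "block_matrix_seq K \<nu> r' s' ?A"
    using glt(1) by (simp add: block_matrix_seq_def)
  moreover have "square_glt K \<nu> t (\<lambda>n. extend_blocks (\<nu> n) r' s' t (?A n))
      (\<lambda>z. extend r' s' t (submatrix (\<kappa> z) I J))" if t: "max r' s' \<le> t" for t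
  proof -
    interpret block_selection t T "{..<r'}" "{..<s'}" "pick I" "pick J"
      using t I J inj[of I] inj[of J] assms by unfold_locales (force simp: T_def)+
    \<comment> \<open>Two routes from an \<open>r\<close> by \<open>s\<close> block to size
      \<open>t\<close>: delete and then pad to \<open>t\<close>, or pad to \<open>T\<close> and then
      select.\<close>
    have ext: "extend r' s' t (Matrix.mat r' s' (\<lambda>(x, y). X $$ (pick I x, pick J y)))
        = sel (extend r s T X)" if "X \<in> carrier_mat r s" for X
      using that t I J
      by (intro eq_matI) (auto simp: extend_def select_def T_def less_max_iff_disj)
    have block: "block n r s X i j \<in> carrier_mat r s" for n :: "'d \<Rightarrow> nat" and X i j
      by (simp add: block_def)
    have "extend_blocks (\<nu> n) r' s' t (?A n) = sel_blocks (\<nu> n) (extend_blocks (\<nu> n) r s T (A n))" for n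
      \<comment> \<open>The blocks of \<open>?A n\<close> are recovered only at multi-indices of the
        form \<open>lex_nth (\<nu> n) k\<close> with \<open>k\<close> in range, which is all that
        \<open>of_blocks\<close> reads.\<close>
      unfolding extend_blocks_def sel_blocks_of_blocks ext[OF block, symmetric]
    proof (rule of_blocks_cong)
      fix k l x y assume kl: "k < level_size (\<nu> n)" "l < level_size (\<nu> n)"
      have "block (\<nu> n) r' s' (?A n) (lex_nth (\<nu> n) k) (lex_nth (\<nu> n) l)
        = Matrix.mat r' s' (\<lambda>(x, y). block (\<nu> n) r s (A n) (lex_nth (\<nu> n) k) (lex_nth (\<nu> n) l)
            $$ (pick I x, pick J y))" (is "?l = ?r")
      proof (rule eq_matI)
        fix u v assume "u < dim_row ?r" "v < dim_col ?r"
        then show "?l $$ (u, v) = ?r $$ (u, v)"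
          using kl by (simp add: block_of_blocks sub[OF block])
      qed (simp_all add: block_def)
      then show "extend r' s' t (block (\<nu> n) r' s' (?A n) (lex_nth (\<nu> n) k) (lex_nth (\<nu> n) l)) $$ (x, y)
        = extend r' s' t (Matrix.mat r' s' (\<lambda>(x, y).
            block (\<nu> n) r s (A n) (lex_nth (\<nu> n) k) (lex_nth (\<nu> n) l) $$ (pick I x, pick J y))) $$ (x, y)"
        by simp
    qed
    then have "square_glt K \<nu> t (\<lambda>n. extend_blocks (\<nu> n) r' s' t (?A n)) (\<lambda>z. sel (extend r s T (\<kappa> z)))"
      using square_glt_sel[OF glt(3)] by simp
    then show ?thesis
    proof (rule square_glt_symbol_cong)
      fix z :: "'d point \<times> 'd point"
      assume "z \<in> unit_cube \<times> freq_cube"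
      then have "\<kappa> z \<in> carrier_mat r s" using glt(2) unfolding measurable_symbol_def by blast
      then show "extend r' s' t (submatrix (\<kappa> z) I J) = sel (extend r s T (\<kappa> z))"
        by (simp add: sub ext)
    qed
  qed
  ultimately show ?thesis unfolding glt_def by blast
qed

end
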